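(* Let $K\subset\mathbf{R}^n$ be non-empty and compact and let $V:\mathbf{R}^n\to[0,\infty)$ be convex and coercive. Let $\lambda\ge 0$ be the smallest value for which there exists $z\in\mathbf{R}^n$ with $K+z\subset V^{-1}([0,\lambda])$. Then $$\lambda=\sup_{\mu\in\mathcal{P}(K)}\operatorname{Var}_V(\mu).$$ Moreover, $\mu\in\mathcal{P}(K)$ attains this supremum if and only if there exists $$z_*\in\operatorname*{argmin}_{z\in\mathbf{R}^n}\int V(x-z)\,d\mu(x)$$ such that $\operatorname{spt}\mu\subset V^{-1}(\lambda)+z_*$.
   Context: $\mathcal{P}(K)$ denotes the set of Borel probability measures on $\mathbf{R}^n$ that vanish outside $K$, and $\operatorname{spt}\mu$ denotes the smallest closed set containing the full mass of $\mu$. The function $V$ is called coercive if its sublevel sets $V^{-1}([0,s])$ are compact for each $s\ge 0$. The generalized variance is $$\operatorname{Var}_V(\mu):=\inf_{z\in\mathbf{R}^n}\int_{\mathbf{R}^n}V(x-z)\,d\mu(x).$$ Here $V^{-1}(\lambda)=\{x\in\mathbf{R}^n : V(x)=\lambda\}$, and for a set $A\subset \mathbf{R}^n$ and $z\in\mathbf{R}^n$, $A+z=\{a+z : a\in A\}$. *)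

theory Defs
  imports "HOL-Probability.Probability"
begin

text \<open>Vanishing outside K is stated through Borel sets disjoint from K, so that it is
  meaningful also when K itself is not measurable.\<close>

definition prob_on :: "'a::euclidean_space set \<Rightarrow> 'a measure set" where
  "prob_on K = {\<mu>. prob_space \<mu> \<and> sets \<mu> = sets borel \<and>
                   (\<forall>A\<in>sets borel. A \<inter> K = {} \<longrightarrow> emeasure \<mu> A = 0)}"

text \<open>The smallest closed set of full mass, as the intersection of all of them; since a
  Euclidean space is second countable, the intersection itself has full mass for
  every Borel probability measure.\<close>

definition spt :: "'a::euclidean_space measure \<Rightarrow> 'a set" where
  "spt \<mu> = \<Inter>{C. closed C \<and> emeasure \<mu> C = emeasure \<mu> (space \<mu>)}"

definition coercive :: "('a::euclidean_space \<Rightarrow> real) \<Rightarrow> bool" where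
  "coercive V \<longleftrightarrow> (\<forall>s\<ge>0. compact (V -` {0..s}))"

text \<open>V is meant to be nonnegative. The integral takes values in the extended nonnegative
  reals, so no integrability side condition arises.\<close>

definition displaced_cost ::
    "('a::euclidean_space \<Rightarrow> real) \<Rightarrow> 'a measure \<Rightarrow> 'a \<Rightarrow> ennreal" where
  "displaced_cost V \<mu> z = (\<integral>\<^sup>+ x. ennreal (V (x - z)) \<partial>\<mu>)"

definition gen_var :: "('a::euclidean_space \<Rightarrow> real) \<Rightarrow> 'a measure \<Rightarrow> ennreal" where
  "gen_var V \<mu> = (INF z. displaced_cost V \<mu> z)"

definition translate :: "'a::euclidean_space set \<Rightarrow> 'a \<Rightarrow> 'a set" where
  "translate A z = (\<lambda>a. a + z) ` A"

definition enclosing_levels ::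
    "'a::euclidean_space set \<Rightarrow> ('a \<Rightarrow> real) \<Rightarrow> real set" where
  "enclosing_levels K V = {s. 0 \<le> s \<and> (\<exists>z. translate K z \<subseteq> V -` {0..s})}"

definition is_smallest :: "real \<Rightarrow> real set \<Rightarrow> bool" where
  "is_smallest l S \<longleftrightarrow> l \<in> S \<and> (\<forall>s\<in>S. l \<le> s)"

end

theory Submission imports Defs begin

text \<open>
  The number \<open>\<lambda>\<close> is the minimum over centres \<open>z\<close> of the worst cost \<open>V (x - z)\<close> over \<open>x \<in> K\<close>,
  while the supremum of the generalized variances is the supremum over \<open>\<mu>\<close> of the infimum
  over \<open>z\<close> of the average cost.  The first half of the theorem is therefore a minimax identity for
  the payoff \<open>\<integral>V (x - z) d\<mu>\<close>, which is convex in \<open>z\<close> and linear in \<open>\<mu>\<close>.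

  An average is at most a maximum, so every variance is at most \<open>\<lambda>\<close>.  For the converse let
  \<open>0 \<le> t < \<lambda>\<close>.  The sets of centres \<open>z\<close> with \<open>V (x - z) \<le> t\<close>, for \<open>x \<in> K\<close>, are compact and have no
  common point; hence finitely many of them, belonging to points of a finite \<open>I \<subseteq> K\<close>, already
  have none.  So the convex functions \<open>V (x - z) - t\<close> of \<open>z\<close>, with \<open>x \<in> I\<close>, are never
  simultaneously negative, and a theorem of the alternative (\<open>convex_alternative\<close>) gives
  convex weights for which their weighted sum is nonnegative everywhere.  The discrete measure
  with these weights has variance at least \<open>t\<close> (\<open>exists_large_gen_var\<close>).

  For the second half, fix a centre \<open>z0\<close> with \<open>V (x - z0) \<le> \<lambda>\<close> on \<open>K\<close>.  If \<open>\<mu>\<close> has variance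
  \<open>\<lambda>\<close>, then its average cost at \<open>z0\<close> is both at least and at most \<open>\<lambda>\<close>; so \<open>z0\<close> is a minimizer,
  and \<open>V (x - z0)\<close>, being bounded almost everywhere by its own mean \<open>\<lambda>\<close>, equals \<open>\<lambda>\<close> almost
  everywhere, hence, by continuity, on the support.  Conversely, a minimizer \<open>z\<close> with \<open>V (x - z) = \<lambda>\<close> on the support has cost
  \<open>\<lambda>\<close>, because the support carries the full mass (\<open>AE_spt\<close>).
\<close>

section \<open>A theorem of the alternative for convex functions\<close>

text \<open>The pairs that dominate some value \<open>(f z, g z)\<close> form a convex set that misses the open
  negative quadrant.  A line separates the two; that one side is a quadrant forces its normal
  to be nonnegative, and the normal supplies the weights.\<close>

lemma convex_alternative_two:
  fixes f g :: "'a::real_vector \<Rightarrow> real"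
  assumes f: "convex_on C f" and g: "convex_on C g"
    and no: "\<not> (\<exists>z\<in>C. f z < 0 \<and> g z < 0)"
  shows "\<exists>a b. 0 \<le> a \<and> 0 \<le> b \<and> a + b = 1 \<and> (\<forall>z\<in>C. 0 \<le> a * f z + b * g z)"
proof (cases "C = {}")
  case True
  then show ?thesis by (intro exI[of _ 1] exI[of _ 0]) auto
next
  case False
  define S where "S = {y :: real \<times> real. \<exists>z\<in>C. f z \<le> fst y \<and> g z \<le> snd y}"
  define T where "T = {..<0::real} \<times> {..<0::real}"
  have "convex S"
  proof (rule convexI)
    fix x y :: "real \<times> real" and u v :: real
    assume "x \<in> S" "y \<in> S" and uv: "0 \<le> u" "0 \<le> v" "u + v = 1"
    then obtain z w where z: "z \<in> C" "f z \<le> fst x" "g z \<le> snd x"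
      and w: "w \<in> C" "f w \<le> fst y" "g w \<le> snd y"
      unfolding S_def by auto
    let ?m = "u *\<^sub>R z + v *\<^sub>R w"
    have "?m \<in> C" using f z w uv by (auto simp: convex_on_def convex_def)
    moreover have "f ?m \<le> u * f z + v * f w" "g ?m \<le> u * g z + v * g w"
      using f g z w uv by (auto simp: convex_on_def)
    moreover have "u * f z + v * f w \<le> u * fst x + v * fst y"
      "u * g z + v * g w \<le> u * snd x + v * snd y"
      using z w uv by (auto intro!: add_mono mult_left_mono)
    ultimately show "u *\<^sub>R x + v *\<^sub>R y \<in> S"
      unfolding S_def by (auto intro!: bexI[of _ ?m])
  qed
  moreover have "convex T" unfolding T_def by (intro convex_Times convex_real_interval)
  moreover have "S \<noteq> {}"
  proof -
    obtain z where "z \<in> C" using False by auto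
    then have "(f z, g z) \<in> S" unfolding S_def by auto
    then show ?thesis by auto
  qed
  moreover have "(-1, -1) \<in> T" unfolding T_def by simp
  then have "T \<noteq> {}" by auto
  moreover have "T \<inter> S = {}"
    using no unfolding S_def T_def by (fastforce intro: le_less_trans)
  ultimately obtain c \<beta> where c: "c \<noteq> 0" "\<forall>y\<in>T. inner c y \<le> \<beta>" "\<forall>y\<in>S. \<beta> \<le> inner c y"
    using separating_hyperplane_sets[of T S] by auto
  obtain a b where ab: "c = (a, b)" by (cases c)
  have T: "a * x + b * y \<le> \<beta>" if "x < 0" "y < 0" for x y
    using c(2) that by (auto simp: ab T_def)
  have S: "\<beta> \<le> a * f z + b * g z" if "z \<in> C" for z
  proof -
    have "(f z, g z) \<in> S" using that unfolding S_def by auto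
    then show ?thesis using c(3) by (auto simp: ab)
  qed
  have a: "0 \<le> a"
  proof (rule ccontr)
    assume n: "\<not> 0 \<le> a"
    \<comment> \<open>far out along the first axis the linear functional would exceed the bound\<close>
    have "a * ((\<bar>\<beta>\<bar> + \<bar>b\<bar> + 1) / a) + b * (-1) \<le> \<beta>"
      using n by (intro T) (auto intro!: divide_pos_neg)
    then show False using n by simp
  qed
  have b: "0 \<le> b"
  proof (rule ccontr)
    assume n: "\<not> 0 \<le> b"
    have "a * (-1) + b * ((\<bar>\<beta>\<bar> + \<bar>a\<bar> + 1) / b) \<le> \<beta>"
      using n by (intro T) (auto intro!: divide_pos_neg)
    then show False using n by simp
  qed
  have pos: "0 < a + b" using a b c(1) by (auto simp: ab less_le zero_prod_def)
  have \<beta>: "0 \<le> \<beta>"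
  proof (rule ccontr)
    assume n: "\<not> 0 \<le> \<beta>"
    \<comment> \<open>on the diagonal of the quadrant this point has value \<open>\<beta> / 2\<close>\<close>
    define e where "e = \<beta> / 2 / (a + b)"
    have "e < 0" using n pos by (auto simp: e_def intro!: divide_neg_pos)
    then have "a * e + b * e \<le> \<beta>" by (intro T)
    moreover have "a * e + b * e = \<beta> / 2"
    proof -
      have cancel: "c * (x / c) = x" if "0 < c" for c x :: real using that by simp
      show ?thesis unfolding e_def distrib_right[symmetric] by (rule cancel[OF pos])
    qed
    ultimately show False using n by simp
  qed
  show ?thesis
  proof (intro exI conjI ballI)
    show "0 \<le> a / (a + b)" "0 \<le> b / (a + b)" using a b pos by auto
    show "a / (a + b) + b / (a + b) = 1" using pos by (simp flip: add_divide_distrib)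
    fix z assume "z \<in> C"
    then have "0 \<le> (a * f z + b * g z) / (a + b)" using S[of z] \<beta> pos by simp
    then show "0 \<le> a / (a + b) * f z + b / (a + b) * g z" by (simp add: add_divide_distrib)
  qed
qed

text \<open>Induction on the number of functions: to absorb a further function \<open>h\<close>, the hypothesis is
  applied on the convex part of the domain where \<open>h\<close> is negative.  There the averaged function
  is nonnegative, so the case of two functions applies to it and \<open>h\<close> on the whole domain.\<close>

lemma convex_alternative:
  fixes f :: "'i \<Rightarrow> 'a::real_vector \<Rightarrow> real"
  assumes "finite I" "I \<noteq> {}" "convex C" "\<And>i. i \<in> I \<Longrightarrow> convex_on C (f i)"
    and "\<not> (\<exists>z\<in>C. \<forall>i\<in>I. f i z < 0)"
  shows "\<exists>p. (\<forall>i\<in>I. 0 \<le> p i) \<and> sum p I = 1 \<and> (\<forall>z\<in>C. 0 \<le> (\<Sum>i\<in>I. p i * f i z))"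
  using assms
proof (induction I arbitrary: C rule: finite_ne_induct)
  case (singleton i)
  then show ?case by (intro exI[of _ "\<lambda>_. 1"]) auto
next
  case (insert k J)
  define D where "D = {z\<in>C. f k z < 0}"
  have fk: "convex_on C (f k)" using insert.prems by auto
  have "convex D"
  proof (rule convexI)
    fix x y :: 'a and u v :: real
    assume xy: "x \<in> D" "y \<in> D" and uv: "0 \<le> u" "0 \<le> v" "u + v = 1"
    have "u *\<^sub>R x + v *\<^sub>R y \<in> C"
      using insert.prems(1) xy uv by (auto simp: D_def convex_def)
    moreover have "f k (u *\<^sub>R x + v *\<^sub>R y) \<le> u * f k x + v * f k y"
      using fk xy uv by (auto simp: D_def convex_on_def)
    moreover have "u * f k x + v * f k y < 0"
      using xy uv by (intro convex_bound_lt) (auto simp: D_def)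
    ultimately show "u *\<^sub>R x + v *\<^sub>R y \<in> D" by (auto simp: D_def)
  qed
  moreover have "convex_on D (f i)" if "i \<in> J" for i
    using insert.prems(2)[of i] that \<open>convex D\<close> by (auto simp: D_def intro: convex_on_subset)
  moreover have "\<not> (\<exists>z\<in>D. \<forall>i\<in>J. f i z < 0)"
    using insert.prems(3) by (auto simp: D_def)
  ultimately obtain q where q: "\<forall>i\<in>J. 0 \<le> q i" "sum q J = 1"
    "\<forall>z\<in>D. 0 \<le> (\<Sum>i\<in>J. q i * f i z)"
    using insert.IH[of D] by blast
  define g where "g = (\<lambda>z. \<Sum>i\<in>J. q i * f i z)"
  have "convex_on C (\<lambda>z. \<Sum>i\<in>L. q i * f i z)" if "L \<subseteq> J" for L
    using finite_subset[OF that insert.hyps(1)] that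
  proof (induction L rule: finite_induct)
    case empty
    then show ?case using insert.prems(1) by (simp add: convex_on_def)
  next
    case (insert i L)
    then show ?case
      using q(1) insert.prems \<open>\<And>i. i \<in> Set.insert k J \<Longrightarrow> convex_on C (f i)\<close>
      by (auto intro!: convex_on_add convex_on_cmul)
  qed
  then have "convex_on C g" by (auto simp: g_def)
  moreover have "\<not> (\<exists>z\<in>C. f k z < 0 \<and> g z < 0)"
    using q(3) by (fastforce simp: D_def g_def)
  ultimately obtain a b where ab: "0 \<le> a" "0 \<le> b" "a + b = 1"
    "\<forall>z\<in>C. 0 \<le> a * f k z + b * g z"
    using convex_alternative_two[OF fk] by blast
  define p where "p = (\<lambda>i. if i = k then a else b * q i)"
  have J: "(\<Sum>i\<in>J. p i * h i) = b * (\<Sum>i\<in>J. q i * h i)" for h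
    unfolding sum_distrib_left using insert.hyps
    by (intro sum.cong) (auto simp: p_def)
  have "sum p J = b" using J[of "\<lambda>_. 1"] q(2) by simp
  then show ?case
    using insert.hyps ab q(1) J by (intro exI[of _ p]) (auto simp: p_def g_def)
qed

section \<open>Measures on a compact set\<close>

text \<open>By second countability the complement of the support is a countable union of open null
  sets.\<close>

lemma AE_spt:
  fixes \<mu> :: "'a::euclidean_space measure"
  assumes "prob_space \<mu>" and s: "sets \<mu> = sets borel"
  shows "AE x in \<mu>. x \<in> spt \<mu>"
proof -
  interpret prob_space \<mu> by fact
  define \<U> where "\<U> = {- C | C. closed C \<and> emeasure \<mu> C = emeasure \<mu> (space \<mu>)}"
  have "open U" if "U \<in> \<U>" for U using that by (auto simp: \<U>_def)
  then obtain \<V> where \<V>: "\<V> \<subseteq> \<U>" "countable \<V>" "\<Union>\<V> = \<Union>\<U>"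
    using Lindelof[of \<U>] by auto
  have "AE x in \<mu>. x \<notin> U" if "U \<in> \<V>" for U
  proof -
    have "U \<in> \<U>" using that \<V>(1) by auto
    then obtain C where C: "U = - C" "closed C" "emeasure \<mu> C = emeasure \<mu> (space \<mu>)"
      unfolding \<U>_def by auto
    have "prob C = 1" using C(3) by (simp add: emeasure_space_1 measure_def)
    then have "AE x in \<mu>. x \<in> C"
      using C(2) s by (intro prob_eq_1[THEN iffD1]) auto
    then show ?thesis by (simp add: C(1))
  qed
  then have "AE x in \<mu>. \<forall>U\<in>\<V>. x \<notin> U" using \<V>(2) by (simp add: AE_ball_countable)
  moreover have "x \<in> spt \<mu> \<longleftrightarrow> x \<notin> \<Union>\<U>" for x
    unfolding spt_def \<U>_def by auto
  ultimately show ?thesis unfolding \<V>(3)[symmetric] by simp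
qed

lemma spt_subset_closed:
  fixes \<mu> :: "'a::euclidean_space measure"
  assumes "closed C" "sets \<mu> = sets borel" "AE x in \<mu>. x \<in> C"
  shows "spt \<mu> \<subseteq> C"
proof -
  have "emeasure \<mu> C = emeasure \<mu> (space \<mu>)"
    using assms by (intro emeasure_eq_AE) auto
  then show ?thesis using assms(1) by (auto simp: spt_def)
qed

lemma AE_prob_on:
  assumes "\<mu> \<in> prob_on K" "closed K"
  shows "AE x in \<mu>. x \<in> K"
proof -
  have "sets \<mu> = sets borel" and "emeasure \<mu> (- K) = 0"
    using assms by (auto simp: prob_on_def)
  then show ?thesis
    using assms(2) by (subst AE_iff_measurable[of "- K"]) (auto dest: sets_eq_imp_space_eq)
qed

lemma exists_discrete_prob_on:
  fixes p :: "'a::euclidean_space \<Rightarrow> real"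
  assumes I: "finite I" "I \<subseteq> K" and p: "\<forall>i\<in>I. 0 \<le> p i" "sum p I = 1"
  shows "\<exists>\<mu>\<in>prob_on K. \<forall>h\<in>borel_measurable borel.
           (\<integral>\<^sup>+ x. h x \<partial>\<mu>) = (\<Sum>i\<in>I. ennreal (p i) * h i)"
proof -
  define p' where "p' = (\<lambda>i. if i \<in> I then p i else 0)"
  have p'0: "0 \<le> p' i" for i using p by (simp add: p'_def)
  have p'1: "(\<integral>\<^sup>+ i. ennreal (p' i) \<partial>count_space UNIV) = 1"
    using I p by (subst nn_integral_count_space'[of I]) (auto simp: p'_def sum_ennreal)
  define P where "P = embed_pmf p'"
  have P: "pmf P i = p' i" for i
    unfolding P_def by (rule pmf_embed_pmf[OF p'0 p'1])
  define \<mu> where "\<mu> = distr (measure_pmf P) borel (\<lambda>x. x)"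
  have int: "(\<integral>\<^sup>+ x. h x \<partial>\<mu>) = (\<Sum>i\<in>I. ennreal (p i) * h i)"
    if "h \<in> borel_measurable borel" for h
  proof -
    have "(\<integral>\<^sup>+ x. h x \<partial>\<mu>) = (\<integral>\<^sup>+ x. h x \<partial>measure_pmf P)"
      unfolding \<mu>_def using that by (subst nn_integral_distr) auto
    also have "\<dots> = (\<integral>\<^sup>+ x. ennreal (p' x) * h x \<partial>count_space UNIV)"
      by (simp add: nn_integral_measure_pmf P)
    also have "\<dots> = (\<Sum>i\<in>I. ennreal (p' i) * h i)"
      using I by (intro nn_integral_count_space') (auto simp: p'_def)
    finally show ?thesis by (simp add: p'_def)
  qed
  have "prob_space \<mu>"
    unfolding \<mu>_def by (intro prob_space.prob_space_distr measure_pmf.prob_space_axioms) auto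
  moreover have "sets \<mu> = sets borel" by (simp add: \<mu>_def)
  moreover have "emeasure \<mu> A = 0" if A: "A \<in> sets borel" "A \<inter> K = {}" for A
  proof -
    have "emeasure \<mu> A = (\<integral>\<^sup>+ x. indicator A x \<partial>\<mu>)"
      using A by (simp add: \<mu>_def)
    also have "\<dots> = (\<Sum>i\<in>I. ennreal (p i) * indicator A i)"
      using A by (intro int) auto
    also have "\<dots> = 0" using A I by (intro sum.neutral) (auto simp: indicator_def)
    finally show ?thesis .
  qed
  ultimately have "\<mu> \<in> prob_on K" by (simp add: prob_on_def)
  then show ?thesis using int by blast
qed

section \<open>The smallest enclosing level\<close>

lemma translate_subset_iff:
  assumes "\<forall>x. 0 \<le> V x"
  shows "translate K z \<subseteq> V -` {0..s} \<longleftrightarrow> (\<forall>x\<in>K. V (x + z) \<le> s)"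
  using assms by (auto simp: translate_def)

text \<open>For levels decreasing to the infimum the admissible shifts form nested nonempty compact
  sets; a common shift encloses \<open>K\<close> at the infimum itself.\<close>

lemma smallest_enclosing_level_exists:
  fixes V :: "'a::euclidean_space \<Rightarrow> real"
  assumes K: "K \<noteq> {}" "compact K" and V: "\<forall>x. 0 \<le> V x" "continuous_on UNIV V" "coercive V"
  shows "\<exists>l. is_smallest l (enclosing_levels K V)"
proof -
  let ?E = "enclosing_levels K V"
  define l where "l = Inf ?E"
  have bdd: "bdd_below ?E" unfolding enclosing_levels_def by (auto intro!: bdd_belowI[of _ 0])
  have ne: "?E \<noteq> {}"
  proof -
    have "compact (V ` K)"
      using K V by (intro compact_continuous_image) (auto intro: continuous_on_subset)
    then have "bounded (V ` K)" by (rule compact_imp_bounded)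
    then obtain M where M: "\<forall>y\<in>V ` K. norm y \<le> M"
      unfolding bounded_iff by auto
    have "V (x + 0) \<le> \<bar>M\<bar>" if "x \<in> K" for x
    proof -
      have "\<bar>V x\<bar> \<le> M" using M that by auto
      then show ?thesis by simp
    qed
    then have "translate K 0 \<subseteq> V -` {0..\<bar>M\<bar>}"
      using translate_subset_iff[OF V(1)] by blast
    then have "\<bar>M\<bar> \<in> ?E" unfolding enclosing_levels_def by (auto intro!: exI[of _ 0])
    then show ?thesis by auto
  qed
  have l0: "0 \<le> l" unfolding l_def using ne
    by (intro cInf_greatest) (auto simp: enclosing_levels_def)
  obtain x0 where x0: "x0 \<in> K" using K by auto
  define F where "F = (\<lambda>n::nat. {z. \<forall>x\<in>K. V (x + z) \<le> l + 1 / real (Suc n)})"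
  have "compact (F n)" for n
  proof -
    let ?s = "l + 1 / real (Suc n)"
    have "compact (V -` {0..?s})" using V(3) l0 unfolding coercive_def by simp
    then have "compact ((+) (- x0) ` (V -` {0..?s}))" by (rule compact_translation)
    moreover have "closed (F n)"
    proof -
      have "F n = (\<Inter>x\<in>K. {z. V (x + z) \<le> ?s})" by (auto simp: F_def)
      moreover have "continuous_on UNIV (\<lambda>z. V (x + z))" for x
        by (intro continuous_on_compose2[OF V(2)] continuous_intros) auto
      then have "closed {z. V (x + z) \<le> ?s}" for x
        by (intro closed_Collect_le continuous_on_const)
      ultimately show ?thesis by (simp add: closed_INT)
    qed
    moreover have "F n \<subseteq> (+) (- x0) ` (V -` {0..?s})"
    proof
      fix z assume "z \<in> F n"
      then have "x0 + z \<in> V -` {0..?s}" using x0 V(1) by (auto simp: F_def)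
      then show "z \<in> (+) (- x0) ` (V -` {0..?s})" by (rule rev_image_eqI) simp
    qed
    ultimately show ?thesis by (metis compact_Int_closed inf.absorb_iff2)
  qed
  moreover have "F n \<noteq> {}" for n
  proof -
    have "l < l + 1 / real (Suc n)" by simp
    then obtain s where "s \<in> ?E" "s < l + 1 / real (Suc n)"
      using cInf_less_iff[OF ne bdd] unfolding l_def by blast
    moreover from this obtain z where "\<forall>x\<in>K. V (x + z) \<le> s"
      using translate_subset_iff[OF V(1)] by (auto simp: enclosing_levels_def)
    ultimately have "z \<in> F n" by (fastforce simp: F_def)
    then show ?thesis by auto
  qed
  moreover have "F n \<subseteq> F m" if "m \<le> n" for m n
  proof -
    have "1 / real (Suc n) \<le> 1 / real (Suc m)" using that by (intro divide_left_mono) auto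
    then show ?thesis unfolding F_def by force
  qed
  ultimately have "\<Inter>(range F) \<noteq> {}" by (rule compact_nest[of F])
  then obtain z where z: "\<And>n. z \<in> F n" by auto
  have "V (x + z) \<le> l" if "x \<in> K" for x
  proof (rule field_le_epsilon)
    fix e :: real assume "0 < e"
    then obtain n where "1 / real (Suc n) < e"
      by (metis inverse_eq_divide reals_Archimedean)
    then show "V (x + z) \<le> l + e" using z[of n] that unfolding F_def by force
  qed
  then have "l \<in> ?E"
    unfolding enclosing_levels_def using l0 translate_subset_iff[OF V(1)] by blast
  then show ?thesis
    unfolding is_smallest_def l_def using bdd by (auto intro: cInf_lower)
qed

section \<open>Bounds on the generalized variance\<close>

lemma borel_measurable_displaced:
  fixes V :: "'a::euclidean_space \<Rightarrow> real"
  assumes "continuous_on UNIV V"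
  shows "(\<lambda>x. ennreal (V (x - z))) \<in> borel_measurable borel"
proof -
  have "continuous_on UNIV (\<lambda>x. V (x - z))"
    by (intro continuous_on_compose2[OF assms] continuous_intros) auto
  then have "(\<lambda>x. V (x - z)) \<in> borel_measurable borel"
    by (rule borel_measurable_continuous_onI)
  then show ?thesis by simp
qed

lemma displaced_cost_le:
  fixes V :: "'a::euclidean_space \<Rightarrow> real"
  assumes "\<mu> \<in> prob_on K" "closed K" "\<forall>x\<in>K. V (x - z) \<le> s"
  shows "displaced_cost V \<mu> z \<le> ennreal s"
proof -
  interpret prob_space \<mu> using assms by (simp add: prob_on_def)
  have "displaced_cost V \<mu> z \<le> (\<integral>\<^sup>+ x. ennreal s \<partial>\<mu>)"
    unfolding displaced_cost_def using AE_prob_on[OF assms(1,2)] assms(3)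
    by (intro nn_integral_mono_AE) (auto intro: ennreal_leI)
  then show ?thesis by (simp add: emeasure_space_1)
qed

text \<open>The nontrivial inequality of the minimax identity.  If \<open>K\<close> does not fit into the level
  \<open>t\<close>, then by compactness of the sets of admissible centres some finite subset of \<open>K\<close> does
  not fit either, and the weights of the alternative for its points form the desired
  measure.\<close>

lemma exists_large_gen_var:
  fixes V :: "'a::euclidean_space \<Rightarrow> real"
  assumes K: "K \<noteq> {}"
    and V: "\<forall>x. 0 \<le> V x" "convex_on UNIV V" "coercive V"
    and t: "0 \<le> t" "t \<notin> enclosing_levels K V"
  shows "\<exists>\<mu>\<in>prob_on K. ennreal t \<le> gen_var V \<mu>"
proof -
  have cont: "continuous_on UNIV V" using V(2) by (intro convex_on_continuous) auto
  define Z where "Z = (\<lambda>x. {z. V (x - z) \<le> t})"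
  have closed: "closed (Z x)" for x
    unfolding Z_def by (intro closed_Collect_le continuous_on_compose2[OF cont] continuous_intros) auto
  have compact: "compact (Z x)" for x
  proof -
    have "compact (V -` {0..t})" using V(3) t(1) by (simp add: coercive_def)
    then have "compact ((\<lambda>y. x - y) ` (V -` {0..t}))"
      by (intro compact_continuous_image continuous_intros)
    moreover have "Z x = (\<lambda>y. x - y) ` (V -` {0..t})"
    proof
      show "Z x \<subseteq> (\<lambda>y. x - y) ` (V -` {0..t})"
      proof
        fix z assume "z \<in> Z x"
        then have "x - z \<in> V -` {0..t}" using V(1) by (simp add: Z_def)
        then show "z \<in> (\<lambda>y. x - y) ` (V -` {0..t})" by (rule rev_image_eqI) simp
      qed
    qed (auto simp: Z_def)
    ultimately show ?thesis by simp
  qed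
  have empty: "\<not> (\<exists>z. \<forall>x\<in>K. V (x - z) \<le> t)"
  proof
    assume "\<exists>z. \<forall>x\<in>K. V (x - z) \<le> t"
    then obtain z where "\<forall>x\<in>K. V (x + (- z)) \<le> t" by auto
    then show False
      using t translate_subset_iff[OF V(1)] unfolding enclosing_levels_def by blast
  qed
  obtain x0 where x0: "x0 \<in> K" using K by auto
  have "Z x0 \<inter> (\<Inter>x\<in>K. Z x) = {}" using empty by (auto simp: Z_def)
  then obtain J where J: "finite J" "J \<subseteq> K" "Z x0 \<inter> (\<Inter>x\<in>J. Z x) = {}"
    using compact_imp_fip_image[OF compact[of x0], of K Z] closed by blast
  define I where "I = insert x0 J"
  have I: "finite I" "I \<noteq> {}" "I \<subseteq> K" using J x0 by (auto simp: I_def)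
  have conv: "convex_on UNIV (\<lambda>z. V (x - z) - t)" for x
    unfolding convex_on_def
  proof (intro conjI ballI allI impI)
    fix y w :: 'a and u v :: real
    assume uv: "0 \<le> u" "0 \<le> v" "u + v = 1"
    have "x = (u + v) *\<^sub>R x" using uv by simp
    then have "x - (u *\<^sub>R y + v *\<^sub>R w) = u *\<^sub>R (x - y) + v *\<^sub>R (x - w)"
      by (simp add: algebra_simps)
    then have "V (x - (u *\<^sub>R y + v *\<^sub>R w)) \<le> u * V (x - y) + v * V (x - w)"
      using V(2) uv by (simp add: convex_on_def)
    moreover have "t = (u + v) * t" using uv by simp
    ultimately show "V (x - (u *\<^sub>R y + v *\<^sub>R w)) - t \<le> u * (V (x - y) - t) + v * (V (x - w) - t)"
      by (simp add: algebra_simps)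
  qed auto
  have "\<not> (\<exists>z\<in>UNIV. \<forall>x\<in>I. V (x - z) - t < 0)"
  proof
    assume "\<exists>z\<in>UNIV. \<forall>x\<in>I. V (x - z) - t < 0"
    then obtain z where "\<forall>x\<in>I. V (x - z) - t < 0" by blast
    then have "z \<in> Z x" if "x \<in> I" for x using that by (fastforce simp: Z_def)
    then show False using J(3) by (auto simp: I_def)
  qed
  then obtain p where p: "\<forall>i\<in>I. 0 \<le> p i" "sum p I = 1"
    "\<And>z. 0 \<le> (\<Sum>x\<in>I. p x * (V (x - z) - t))"
    using convex_alternative[of I UNIV "\<lambda>x z. V (x - z) - t"] I conv by auto
  obtain \<mu> where \<mu>: "\<mu> \<in> prob_on K"
    "\<And>h. h \<in> borel_measurable borel \<Longrightarrow> (\<integral>\<^sup>+ x. h x \<partial>\<mu>) = (\<Sum>i\<in>I. ennreal (p i) * h i)"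
    using exists_discrete_prob_on[OF I(1,3) p(1,2)] by auto
  have "ennreal t \<le> displaced_cost V \<mu> z" for z
  proof -
    have "displaced_cost V \<mu> z = (\<Sum>x\<in>I. ennreal (p x) * ennreal (V (x - z)))"
      unfolding displaced_cost_def by (intro \<mu>(2) borel_measurable_displaced cont)
    also have "\<dots> = (\<Sum>x\<in>I. ennreal (p x * V (x - z)))"
      using p(1) V(1) by (intro sum.cong) (auto simp: ennreal_mult)
    also have "\<dots> = ennreal (\<Sum>x\<in>I. p x * V (x - z))"
      using p(1) V(1) by (intro sum_ennreal) auto
    finally have eq: "displaced_cost V \<mu> z = ennreal (\<Sum>x\<in>I. p x * V (x - z))" .
    have "t \<le> (\<Sum>x\<in>I. p x * V (x - z))"
      using p(3)[of z] p(2) by (simp add: right_diff_distrib sum_subtractf flip: sum_distrib_right)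
    then show ?thesis unfolding eq by (rule ennreal_leI)
  qed
  then show ?thesis using \<mu>(1) unfolding gen_var_def by (auto intro: INF_greatest)
qed

text \<open>The difference \<open>l - f\<close> is nonnegative almost everywhere and has integral zero.\<close>

lemma (in prob_space) AE_eq_mean_of_le_mean:
  fixes f :: "'a \<Rightarrow> real"
  assumes meas: "(\<lambda>x. ennreal (f x)) \<in> borel_measurable M"
    and f: "\<And>x. 0 \<le> f x" "AE x in M. f x \<le> l"
    and mean: "(\<integral>\<^sup>+ x. ennreal (f x) \<partial>M) = ennreal l"
  shows "AE x in M. f x = l"
proof -
  have "(\<integral>\<^sup>+ x. ennreal l - ennreal (f x) \<partial>M)
      = (\<integral>\<^sup>+ x. ennreal l \<partial>M) - (\<integral>\<^sup>+ x. ennreal (f x) \<partial>M)"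
    using f mean meas by (intro nn_integral_diff) (auto simp: ennreal_leI)
  also have "\<dots> = 0" by (simp add: mean emeasure_space_1)
  finally have "AE x in M. ennreal l - ennreal (f x) = 0"
    using meas by (subst (asm) nn_integral_0_iff_AE) auto
  then show ?thesis
    using f(2)
  proof eventually_elim
    case (elim x)
    then have "ennreal l \<le> ennreal (f x)" by (simp add: ennreal_minus_eq_0)
    then show ?case using elim f(1)[of x] by (auto simp: ennreal_le_iff)
  qed
qed

section \<open>The minimax identity and its maximizers\<close>

lemma smallest_level_eq_SUP_gen_var:
  fixes V :: "'a::euclidean_space \<Rightarrow> real"
  assumes K: "K \<noteq> {}" "compact K"
    and V: "\<forall>x. 0 \<le> V x" "convex_on UNIV V" "coercive V"
    and l: "is_smallest l (enclosing_levels K V)"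
  shows "ennreal l = (SUP \<mu>\<in>prob_on K. gen_var V \<mu>)"
proof (rule antisym)
  have l0: "0 \<le> l" using l by (auto simp: is_smallest_def enclosing_levels_def)
  show "ennreal l \<le> (SUP \<mu>\<in>prob_on K. gen_var V \<mu>)"
  proof (rule ccontr)
    assume "\<not> ?thesis"
    then have less: "(SUP \<mu>\<in>prob_on K. gen_var V \<mu>) < ennreal l" by simp
    then obtain r where r: "0 \<le> r" "(SUP \<mu>\<in>prob_on K. gen_var V \<mu>) = ennreal r"
      by (cases "SUP \<mu>\<in>prob_on K. gen_var V \<mu>") auto
    have rl: "r < l" using less r l0 by (simp add: ennreal_less_iff)
    then have "(r + l) / 2 \<notin> enclosing_levels K V"
      using l by (auto simp: is_smallest_def)
    then obtain \<mu> where \<mu>: "\<mu> \<in> prob_on K" "ennreal ((r + l) / 2) \<le> gen_var V \<mu>"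
      using exists_large_gen_var[OF K(1) V, of "(r + l) / 2"] r(1) l0 by auto
    then have "ennreal ((r + l) / 2) \<le> ennreal r"
      using r(2) by (metis SUP_upper order_trans)
    then show False using r(1) rl by (simp add: ennreal_le_iff)
  qed
  obtain z where "\<forall>x\<in>K. V (x + z) \<le> l"
    using l translate_subset_iff[OF V(1)] by (auto simp: is_smallest_def enclosing_levels_def)
  then have z: "\<forall>x\<in>K. V (x - (- z)) \<le> l" by simp
  show "(SUP \<mu>\<in>prob_on K. gen_var V \<mu>) \<le> ennreal l"
  proof (rule SUP_least)
    fix \<mu> assume "\<mu> \<in> prob_on K"
    then have "displaced_cost V \<mu> (- z) \<le> ennreal l"
      using compact_imp_closed[OF K(2)] z by (rule displaced_cost_le)
    then show "gen_var V \<mu> \<le> ennreal l"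
      unfolding gen_var_def by (meson INF_lower UNIV_I order_trans)
  qed
qed

lemma mem_translate_iff: "x \<in> translate A z \<longleftrightarrow> x - z \<in> A"
proof
  assume "x - z \<in> A"
  then show "x \<in> translate A z" unfolding translate_def by (rule rev_image_eqI) simp
qed (auto simp: translate_def)

lemma gen_var_eq_smallest_level_iff:
  fixes V :: "'a::euclidean_space \<Rightarrow> real"
  assumes K: "compact K"
    and V: "\<forall>x. 0 \<le> V x" "continuous_on UNIV V"
    and l: "l \<in> enclosing_levels K V" and \<mu>: "\<mu> \<in> prob_on K"
  shows "gen_var V \<mu> = ennreal l \<longleftrightarrow>
    (\<exists>z. is_arg_min (displaced_cost V \<mu>) (\<lambda>_. True) z \<and> spt \<mu> \<subseteq> translate (V -` {l}) z)"
proof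
  interpret prob_space \<mu> using \<mu> by (simp add: prob_on_def)
  have sets: "sets \<mu> = sets borel" using \<mu> by (simp add: prob_on_def)
  {
    assume eq: "gen_var V \<mu> = ennreal l"
    obtain y where "\<forall>x\<in>K. V (x + y) \<le> l"
      using l translate_subset_iff[OF V(1)] by (auto simp: enclosing_levels_def)
    moreover define z where "z = - y"
    ultimately have z: "\<forall>x\<in>K. V (x - z) \<le> l" by simp
    have le: "displaced_cost V \<mu> z \<le> ennreal l"
      by (rule displaced_cost_le[OF \<mu> compact_imp_closed[OF K] z])
    have ge: "ennreal l \<le> displaced_cost V \<mu> w" for w
      unfolding eq[symmetric] gen_var_def by (rule INF_lower) simp
    have "is_arg_min (displaced_cost V \<mu>) (\<lambda>_. True) z"
      using le ge by (auto simp: is_arg_min_def not_less intro: order_trans)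
    moreover have "AE x in \<mu>. V (x - z) = l"
    proof (rule AE_eq_mean_of_le_mean)
      show "(\<lambda>x. ennreal (V (x - z))) \<in> borel_measurable \<mu>"
        using borel_measurable_displaced[OF V(2)] sets by (simp cong: measurable_cong_sets)
      show "AE x in \<mu>. V (x - z) \<le> l"
        using AE_prob_on[OF \<mu> compact_imp_closed[OF K]] z by auto
      show "(\<integral>\<^sup>+ x. ennreal (V (x - z)) \<partial>\<mu>) = ennreal l"
        using antisym[OF le ge] by (simp add: displaced_cost_def)
    qed (use V in auto)
    then have "spt \<mu> \<subseteq> {x. V (x - z) = l}"
      using sets
      by (intro spt_subset_closed closed_Collect_eq continuous_on_compose2[OF V(2)]
          continuous_intros) auto
    then have "spt \<mu> \<subseteq> translate (V -` {l}) z" by (auto simp: mem_translate_iff)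
    ultimately show "\<exists>z. is_arg_min (displaced_cost V \<mu>) (\<lambda>_. True) z
        \<and> spt \<mu> \<subseteq> translate (V -` {l}) z"
      by blast
  }
  assume "\<exists>z. is_arg_min (displaced_cost V \<mu>) (\<lambda>_. True) z \<and> spt \<mu> \<subseteq> translate (V -` {l}) z"
  then obtain z where z: "is_arg_min (displaced_cost V \<mu>) (\<lambda>_. True) z"
    "spt \<mu> \<subseteq> translate (V -` {l}) z" by blast
  have "gen_var V \<mu> = displaced_cost V \<mu> z"
    unfolding gen_var_def using z(1)
    by (intro antisym INF_lower INF_greatest) (auto simp: is_arg_min_def not_less)
  also have "\<dots> = (\<integral>\<^sup>+ x. ennreal l \<partial>\<mu>)"
    unfolding displaced_cost_def
  proof (rule nn_integral_cong_AE)
    show "AE x in \<mu>. ennreal (V (x - z)) = ennreal l"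
      using AE_spt[OF prob_space_axioms sets]
    proof eventually_elim
      case (elim x)
      then show ?case using z(2) by (auto simp: mem_translate_iff)
    qed
  qed
  also have "\<dots> = ennreal l" by (simp add: emeasure_space_1)
  finally show "gen_var V \<mu> = ennreal l" .
qed

theorem theorem1p7:
  fixes K :: "(real ^ 'n) set" and V :: "real ^ 'n \<Rightarrow> real"
  assumes "K \<noteq> {}" and "compact K"
    and "\<forall>x. 0 \<le> V x" and "convex_on UNIV V" and "coercive V"
  shows "(\<exists>l. is_smallest l (enclosing_levels K V)) \<and>
    (\<forall>l. is_smallest l (enclosing_levels K V) \<longrightarrow>
      ennreal l = (SUP \<mu>\<in>prob_on K. gen_var V \<mu>) \<and>
      (\<forall>\<mu>\<in>prob_on K.
        gen_var V \<mu> = (SUP \<nu>\<in>prob_on K. gen_var V \<nu>) \<longleftrightarrow>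
        (\<exists>z. is_arg_min (displaced_cost V \<mu>) (\<lambda>_. True) z \<and>
             spt \<mu> \<subseteq> translate (V -` {l}) z)))"
proof -
  have cont: "continuous_on UNIV V" using assms(4) by (intro convex_on_continuous) auto
  have "ennreal l = (SUP \<mu>\<in>prob_on K. gen_var V \<mu>) \<and>
      (\<forall>\<mu>\<in>prob_on K.
        gen_var V \<mu> = (SUP \<nu>\<in>prob_on K. gen_var V \<nu>) \<longleftrightarrow>
        (\<exists>z. is_arg_min (displaced_cost V \<mu>) (\<lambda>_. True) z \<and>
             spt \<mu> \<subseteq> translate (V -` {l}) z))"
    if l: "is_smallest l (enclosing_levels K V)" for l
  proof -
    have eq: "ennreal l = (SUP \<mu>\<in>prob_on K. gen_var V \<mu>)"
      by (rule smallest_level_eq_SUP_gen_var[OF assms l])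
    have "l \<in> enclosing_levels K V" using l by (simp add: is_smallest_def)
    then show ?thesis
      using gen_var_eq_smallest_level_iff[OF assms(2,3) cont]
      by (auto simp flip: eq)
  qed
  then show ?thesis
    using smallest_enclosing_level_exists[OF assms(1-3) cont assms(5)] by blast
qed

end
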